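(* Let $C\in\mathbb{R}^{n_y\times n_x}$, $A^\star\in\mathbb{R}^{n_x\times n_x}$, $B^\star\in\mathbb{R}^{n_x\times n_u}$, $k^\star:\mathbb{R}^{n_x}\to\mathbb{R}^{n_x}$ and $y^{\rm d}\in\mathbb{R}^{n_y}$. Suppose that there exists a pair $(x^{\rm d},u^{\rm d})\in\mathbb{R}^{n_x}\times\mathbb{R}^{n_u}$ such that $$y^{\rm d}=Cx^{\rm d}\quad\text{and}\quad A^\star x^{\rm d}+k^\star(x^{\rm d})=-B^\star u^{\rm d}.$$ Consider the closed-loop system consisting of the plant $$\dot x(t)=A^\star x(t)+B^\star u(t)+k^\star(x(t)),\qquad y(t)=Cx(t),$$ and the dynamic controller $$\dot w(t)=A_c w(t)+B_c y(t)+\xi,\qquad u(t)=C_c w(t)+D_c y(t)+\eta,$$ where $A_c,C_c\in\mathbb{R}^{n_u\times n_u}$, $B_c,D_c\in\mathbb{R}^{n_u\times n_y}$ and $\xi,\eta\in\mathbb{R}^{n_u}$. If the matrix $C_c$ has full column rank, $A_c=0$ and $\xi=-B_c y^{\rm d}$, then there exists $w^{\rm d}\in\mathbb{R}^{n_u}$ such that $(x^{\rm d},w^{\rm d})$ is an equilibrium of the closed-loop system.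
   Context: Here $x(t)\in\mathbb{R}^{n_x}$ is the plant state, $u(t)\in\mathbb{R}^{n_u}$ the control, $y(t)\in\mathbb{R}^{n_y}$ the output and $w(t)\in\mathbb{R}^{n_u}$ the controller state. An equilibrium is a pair $(x,w)$ at which the right-hand sides of the $\dot x$ and $\dot w$ equations of the closed-loop system vanish. *)

theory Defs
  imports "HOL-Analysis.Analysis"
begin

definition plant_rhs ::
  "real^'nx^'nx \<Rightarrow> real^'nu^'nx \<Rightarrow> (real^'nx \<Rightarrow> real^'nx) \<Rightarrow> real^'nx \<Rightarrow> real^'nu \<Rightarrow> real^'nx" where
  "plant_rhs A B k x u = A *v x + B *v u + k x"

definition controller_rhs ::
  "real^'nu^'nu \<Rightarrow> real^'ny^'nu \<Rightarrow> real^'nu \<Rightarrow> real^'nu \<Rightarrow> real^'ny \<Rightarrow> real^'nu" where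
  "controller_rhs Ac Bc \<xi> w y = Ac *v w + Bc *v y + \<xi>"

definition controller_output ::
  "real^'nu^'nu \<Rightarrow> real^'ny^'nu \<Rightarrow> real^'nu \<Rightarrow> real^'nu \<Rightarrow> real^'ny \<Rightarrow> real^'nu" where
  "controller_output Cc Dc \<eta> w y = Cc *v w + Dc *v y + \<eta>"

text \<open>The plant has no direct feedthrough (\<open>y = C x\<close>), so \<open>y\<close> and then \<open>u\<close> are explicit functions
  of the joint state \<open>(x, w)\<close>, and the closed loop is the autonomous system whose vector field is:\<close>

definition closed_loop_rhs ::
  "real^'nx^'nx \<Rightarrow> real^'nu^'nx \<Rightarrow> real^'nx^'ny \<Rightarrow> (real^'nx \<Rightarrow> real^'nx) \<Rightarrow>
   real^'nu^'nu \<Rightarrow> real^'ny^'nu \<Rightarrow> real^'nu^'nu \<Rightarrow> real^'ny^'nu \<Rightarrow> real^'nu \<Rightarrow> real^'nu \<Rightarrow>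
   (real^'nx) \<times> (real^'nu) \<Rightarrow> (real^'nx) \<times> (real^'nu)" where
  "closed_loop_rhs A B C k Ac Bc Cc Dc \<xi> \<eta> = (\<lambda>(x, w).
     let y = C *v x;
         u = controller_output Cc Dc \<eta> w y
     in (plant_rhs A B k x u, controller_rhs Ac Bc \<xi> w y))"

definition is_equilibrium :: "('a::zero \<Rightarrow> 'a) \<Rightarrow> 'a \<Rightarrow> bool" where
  "is_equilibrium f z \<longleftrightarrow> f z = 0"

definition full_column_rank :: "real^'n^'m \<Rightarrow> bool" where
  "full_column_rank M \<longleftrightarrow> rank M = CARD('n)"

end

theory Submission
  imports Defs
begin

text \<open>When the plant state is \<open>xd\<close>, the output is \<open>yd\<close> and the offset \<open>\<xi> = - Bc yd\<close> cancels \<open>Bc y\<close>, so with \<open>Ac = 0\<close> the controller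
  state is stationary at every \<open>w\<close>. The choice of \<open>w\<close> is therefore free to serve the plant, which
  is at rest once the control equals \<open>ud\<close>. Since \<open>Cc\<close> is square, full column rank makes it
  surjective, and so \<open>Cc w + Dc yd + \<eta> = ud\<close> has a solution \<open>w\<close>.\<close>

theorem lemma3p1:
  fixes C :: "real^'nx^'ny"
    and A :: "real^'nx^'nx"
    and B :: "real^'nu^'nx"
    and k :: "real^'nx \<Rightarrow> real^'nx"
    and yd :: "real^'ny"
    and xd :: "real^'nx"
    and ud :: "real^'nu"
    and Ac Cc :: "real^'nu^'nu"
    and Bc Dc :: "real^'ny^'nu"
    and \<xi> \<eta> :: "real^'nu"
  assumes "yd = C *v xd"
    and "A *v xd + k xd = - (B *v ud)"
    and "full_column_rank Cc"
    and "Ac = 0"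
    and "\<xi> = - (Bc *v yd)"
  shows "\<exists>wd :: real^'nu. is_equilibrium (closed_loop_rhs A B C k Ac Bc Cc Dc \<xi> \<eta>) (xd, wd)"
proof -
  have "surj ((*v) Cc)"
    using assms(3) by (simp add: full_column_rank_def full_rank_surjective)
  then obtain wd where "Cc *v wd = ud - Dc *v yd - \<eta>"
    by (metis surjD)
  then have control: "controller_output Cc Dc \<eta> wd yd = ud"
    by (simp add: controller_output_def)
  have "plant_rhs A B k xd ud = (A *v xd + k xd) + B *v ud"
    by (simp add: plant_rhs_def add.commute add.left_commute)
  then have "plant_rhs A B k xd ud = 0"
    using assms(2) by simp
  moreover have "controller_rhs Ac Bc \<xi> wd yd = 0"
    using assms(4,5) by (simp add: controller_rhs_def)
  ultimately have "is_equilibrium (closed_loop_rhs A B C k Ac Bc Cc Dc \<xi> \<eta>) (xd, wd)"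
    using control assms(1)
    by (simp add: is_equilibrium_def closed_loop_rhs_def zero_prod_def)
  then show ?thesis ..
qed

end
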